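(* Let $D$ be a Prüfer domain and let $P\in\operatorname{Spec}(D)$. The following are equivalent: (i) $P\in\operatorname{Spec}^\ast(D)$, i.e. $PD^\ast\neq D^\ast$; (ii) if $I,J$ are finitely generated ideals of $D$ such that $(0)\neq I\subsetneq J\subseteq P$, then $\operatorname{Min}(I)\cap\operatorname{Min}(J)\neq\emptyset$.
   Context: A Prüfer domain is an integral domain $D$ such that $D_P$ is a valuation domain for every $P\in\operatorname{Spec}(D)$. Let $K$ be the quotient field of $D$. An element $z\in K$ is almost integral over $D$ if there is a nonzero $c\in D$ such that $cz^n\in D$ for every positive integer $n$; the complete integral closure $D^\ast$ of $D$ is the ring of all elements of $K$ that are almost integral over $D$. $\operatorname{Spec}^\ast(D)$ denotes the set of all $P\in\operatorname{Spec}(D)$ such that $PD^\ast\neq D^\ast$. For a proper ideal $I$, $\operatorname{Min}(I)$ denotes the set of minimal primes of $I$, i.e. the minimal elements (under inclusion) of the set $\mathcal{V}(I)$ of prime ideals of $D$ containing $I$. *)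

theory Defs
  imports "HOL-Algebra.Subrings"
begin

text \<open>
  An integral domain is represented as a subring \<open>D\<close> of its quotient field \<open>K\<close>, so that
  localizations and the complete integral closure are literally overrings of \<open>D\<close> inside \<open>K\<close>.
  Ideals of \<open>D\<close> are ideals of the ring \<open>K\<lparr>carrier := D\<rparr>\<close>.
\<close>

definition is_quotient_field :: "('a, 'b) ring_scheme \<Rightarrow> 'a set \<Rightarrow> bool" where
  "is_quotient_field K D \<longleftrightarrow>
     field K \<and> subdomain D K \<and>
     (\<forall>z \<in> carrier K. \<exists>a \<in> D. \<exists>b \<in> D - {\<zero>\<^bsub>K\<^esub>}. z = a \<otimes>\<^bsub>K\<^esub> inv\<^bsub>K\<^esub> b)"

definition valuation_domain :: "('a, 'b) ring_scheme \<Rightarrow> 'a set \<Rightarrow> bool" where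
  "valuation_domain K V \<longleftrightarrow>
     is_quotient_field K V \<and> (\<forall>x \<in> carrier K - {\<zero>\<^bsub>K\<^esub>}. x \<in> V \<or> inv\<^bsub>K\<^esub> x \<in> V)"

definition Spec :: "('a, 'b) ring_scheme \<Rightarrow> 'a set \<Rightarrow> 'a set set" where
  "Spec K D = {P. primeideal P (K\<lparr>carrier := D\<rparr>)}"

definition localization_at :: "('a, 'b) ring_scheme \<Rightarrow> 'a set \<Rightarrow> 'a set \<Rightarrow> 'a set" where
  "localization_at K D P = {a \<otimes>\<^bsub>K\<^esub> inv\<^bsub>K\<^esub> s | a s. a \<in> D \<and> s \<in> D - P}"

definition pruefer_domain :: "('a, 'b) ring_scheme \<Rightarrow> 'a set \<Rightarrow> bool" where
  "pruefer_domain K D \<longleftrightarrow>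
     is_quotient_field K D \<and> (\<forall>P \<in> Spec K D. valuation_domain K (localization_at K D P))"

definition almost_integral :: "('a, 'b) ring_scheme \<Rightarrow> 'a set \<Rightarrow> 'a \<Rightarrow> bool" where
  "almost_integral K D z \<longleftrightarrow>
     (\<exists>c \<in> D - {\<zero>\<^bsub>K\<^esub>}. \<forall>n::nat. n > 0 \<longrightarrow> c \<otimes>\<^bsub>K\<^esub> z [^]\<^bsub>K\<^esub> n \<in> D)"

definition complete_integral_closure :: "('a, 'b) ring_scheme \<Rightarrow> 'a set \<Rightarrow> 'a set" where
  "complete_integral_closure K D = {z \<in> carrier K. almost_integral K D z}"

definition extended_ideal :: "('a, 'b) ring_scheme \<Rightarrow> 'a set \<Rightarrow> 'a set \<Rightarrow> 'a set" where
  "extended_ideal K T I = Idl\<^bsub>K\<lparr>carrier := T\<rparr>\<^esub> I"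

definition Spec_star :: "('a, 'b) ring_scheme \<Rightarrow> 'a set \<Rightarrow> 'a set set" where
  "Spec_star K D =
     {P \<in> Spec K D.
        extended_ideal K (complete_integral_closure K D) P \<noteq> complete_integral_closure K D}"

definition fin_gen_ideal :: "('a, 'b) ring_scheme \<Rightarrow> 'a set \<Rightarrow> 'a set \<Rightarrow> bool" where
  "fin_gen_ideal K D I \<longleftrightarrow> (\<exists>A \<subseteq> D. finite A \<and> I = Idl\<^bsub>K\<lparr>carrier := D\<rparr>\<^esub> A)"

definition primes_containing :: "('a, 'b) ring_scheme \<Rightarrow> 'a set \<Rightarrow> 'a set \<Rightarrow> 'a set set" where
  "primes_containing K D I = {Q \<in> Spec K D. I \<subseteq> Q}"

definition minimal_primes :: "('a, 'b) ring_scheme \<Rightarrow> 'a set \<Rightarrow> 'a set \<Rightarrow> 'a set set" where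
  "minimal_primes K D I =
     {Q \<in> primes_containing K D I. \<forall>Q' \<in> primes_containing K D I. Q' \<subseteq> Q \<longrightarrow> Q' = Q}"

end

theory Submission
  imports Defs
begin

text \<open>
  Suppose \<open>1 \<in> P D\<^sup>*\<close>. Comparing the summands of \<open>1 = \<Sum> p\<^sub>i z\<^sub>i\<close> in each valuation ring \<open>D\<^sub>Q\<close> gives
  one nonzero \<open>c \<in> D\<close> such that for every \<open>Q\<close> some \<open>p = p\<^sub>i\<close> satisfies \<open>c \<in> p\<^sup>n D\<^sub>Q\<close> for all \<open>n\<close>.
  Let \<open>J\<close> be generated by the \<open>p\<^sub>i\<close> and let \<open>I\<close> be generated by \<open>c p\<^sub>j\<close> for some \<open>p\<^sub>j \<noteq> 0\<close>.
  If \<open>J \<subseteq> Q\<close>, then \<open>D \<inter> (\<Inter>n. p\<^sup>n D\<^sub>Q)\<close> is a prime ideal containing \<open>I\<close> and strictly smaller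
  than \<open>Q\<close>, so \<open>I\<close> and \<open>J\<close> have no minimal prime in common.

  Conversely, let \<open>I \<subseteq> J \<subseteq> P\<close> have no common minimal prime. Inside every prime \<open>Q \<supseteq> J\<close> there is a
  prime \<open>Q'\<close> that contains \<open>I\<close> but misses some \<open>x \<in> J\<close>, so \<open>c \<in> I\<close> is divisible by all powers of
  \<open>x\<close> in \<open>D\<^sub>Q\<close> and \<open>c z\<^sup>n \<in> D\<^sub>Q\<close> whenever \<open>z J \<subseteq> D\<close>. Hence \<open>J\<^sup>-\<^sup>1 \<subseteq> D\<^sup>*\<close>, and since \<open>J\<close> is
  invertible, \<open>1 \<in> J J\<^sup>-\<^sup>1 \<subseteq> P D\<^sup>*\<close>.
\<close>

section \<open>Ideals of subrings and existence of prime ideals in commutative rings\<close>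

text \<open>Closure under negation comes from absorption, applied to the negative of the unit of
  \<open>T\<close>; commutativity turns right absorption into two-sided absorption.\<close>

lemma (in cring) ideal_of_subring_iff:
  assumes "subring T R"
  shows "ideal I (R\<lparr>carrier := T\<rparr>) \<longleftrightarrow>
    I \<subseteq> T \<and> \<zero> \<in> I \<and> (\<forall>x\<in>I. \<forall>y\<in>I. x \<oplus> y \<in> I) \<and> (\<forall>x\<in>I. \<forall>t\<in>T. x \<otimes> t \<in> I)"
    (is "?L \<longleftrightarrow> ?R")
proof
  let ?S = "R\<lparr>carrier := T\<rparr>"
  assume L: ?L
  then have "additive_subgroup I ?S"
    by (rule ideal.axioms)
  then show ?R
    using additive_subgroup.a_subset[of I ?S] additive_subgroup.zero_closed[of I ?S]
      additive_subgroup.a_closed[of I ?S] ideal.I_r_closed[OF L]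
    by auto
next
  let ?S = "R\<lparr>carrier := T\<rparr>"
  assume r: ?R
  have S: "ring ?S"
    by (rule subring_is_ring[OF assms])
  have T: "T \<subseteq> carrier R"
    using subringE(1)[OF assms] .
  have comm: "x \<otimes> t = t \<otimes> x" if "x \<in> I" "t \<in> T" for x t
    using that r T by (meson m_comm subsetD)
  have neg: "\<ominus>\<^bsub>?S\<^esub> x \<in> I" if "x \<in> I" for x
  proof -
    have one: "\<one>\<^bsub>?S\<^esub> \<in> carrier ?S" and x: "x \<in> carrier ?S"
      using r that subringE(3)[OF assms] by auto
    have "\<ominus>\<^bsub>?S\<^esub> x = x \<otimes>\<^bsub>?S\<^esub> (\<ominus>\<^bsub>?S\<^esub> \<one>\<^bsub>?S\<^esub>)"
      using ring.r_minus[OF S x one] monoid.r_one[OF ring.is_monoid[OF S] x] by simp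
    moreover have "\<ominus>\<^bsub>?S\<^esub> \<one>\<^bsub>?S\<^esub> \<in> T"
      using abelian_group.a_inv_closed[OF ring.is_abelian_group[OF S] one] by simp
    ultimately show ?thesis
      using r that by simp
  qed
  have "subgroup I (add_monoid ?S)"
    using r neg
    by (intro group.subgroupI abelian_group.a_group ring.is_abelian_group S) (auto simp: a_inv_def)
  then show ?L
    using r by (intro idealI[OF S]) (auto simp: comm[symmetric])
qed

lemma (in cring) ideal_iff:
  "ideal I R \<longleftrightarrow> I \<subseteq> carrier R \<and> \<zero> \<in> I \<and>
    (\<forall>x\<in>I. \<forall>y\<in>I. x \<oplus> y \<in> I) \<and> (\<forall>x\<in>I. \<forall>t\<in>carrier R. x \<otimes> t \<in> I)"
  using ideal_of_subring_iff[OF carrier_is_subring, of I] by simp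

text \<open>Zorn's lemma on the ideals that contain \<open>I\<close> and avoid
  \<open>\<one>\<close>. An ideal containing \<open>\<one>\<close> is the whole ring, so a maximal
  element of this family is a maximal ideal, hence prime.\<close>

lemma (in cring) proper_ideal_imp_prime:
  assumes I: "ideal I R" and "\<one> \<notin> I"
  shows "\<exists>Q. primeideal Q R \<and> I \<subseteq> Q"
proof -
  let ?A = "{J. ideal J R \<and> I \<subseteq> J \<and> \<one> \<notin> J}"
  have "\<exists>M\<in>?A. \<forall>X\<in>?A. M \<subseteq> X \<longrightarrow> X = M"
  proof (rule subset_Zorn_nonempty)
    show "?A \<noteq> {}"
      using assms by blast
  next
    fix C assume "C \<noteq> {}" and C: "subset.chain ?A C"
    then obtain J0 where J0: "J0 \<in> C"
      by blast
    have sub: "C \<subseteq> ?A" and total: "X \<subseteq> Y \<or> Y \<subseteq> X" if "X \<in> C" "Y \<in> C" for X Y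
      using C that unfolding subset.chain_def by blast+
    have id: "ideal J R" "I \<subseteq> J" "\<one> \<notin> J" if "J \<in> C" for J
      using sub[OF J0 J0] that by auto
    have add: "x \<oplus> y \<in> \<Union>C" if "x \<in> \<Union>C" "y \<in> \<Union>C" for x y
    proof -
      obtain X Y where XY: "x \<in> X" "X \<in> C" "y \<in> Y" "Y \<in> C"
        using \<open>x \<in> \<Union>C\<close> \<open>y \<in> \<Union>C\<close> by blast
      then obtain Z where "Z \<in> C" "x \<in> Z" "y \<in> Z"
        using total[OF XY(2,4)] by blast
      then show ?thesis
        using id(1)[of Z, unfolded ideal_iff] by blast
    qed
    have "ideal (\<Union>C) R"
      unfolding ideal_iff
    proof (intro conjI ballI)
      show "\<Union>C \<subseteq> carrier R"
        using id(1) unfolding ideal_iff by blast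
      show "\<zero> \<in> \<Union>C"
        using id(1)[OF J0] J0 unfolding ideal_iff by blast
      show "x \<oplus> y \<in> \<Union>C" if "x \<in> \<Union>C" "y \<in> \<Union>C" for x y
        using add that .
      show "x \<otimes> t \<in> \<Union>C" if "x \<in> \<Union>C" "t \<in> carrier R" for x t
        using id(1) that unfolding ideal_iff by blast
    qed
    then show "\<Union>C \<in> ?A"
      using J0 id by blast
  qed
  then obtain M where M: "ideal M R" "I \<subseteq> M" "\<one> \<notin> M"
    and max: "\<And>X. ideal X R \<Longrightarrow> M \<subseteq> X \<Longrightarrow> \<one> \<notin> X \<Longrightarrow> X = M"
    by (metis (mono_tags, lifting) mem_Collect_eq order_trans)
  have "maximalideal M R"
  proof (rule maximalidealI[OF M(1)])
    show "carrier R \<noteq> M"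
      using M(3) by auto
    show "J = M \<or> J = carrier R" if "ideal J R" "M \<subseteq> J" "J \<subseteq> carrier R" for J
      using max that ideal.one_imp_carrier by blast
  qed
  then show ?thesis
    using maximalideal_prime M(2) by blast
qed

text \<open>Zorn's lemma for reversed inclusion on the primes between \<open>S\<close> and
  \<open>P\<close>. The intersection of a nonempty chain of primes is prime: if one member misses
  \<open>a\<close> and another misses \<open>b\<close>, the smaller of the two misses both, hence
  also \<open>a \<otimes> b\<close>.\<close>

lemma (in cring) exists_minimal_prime_below:
  assumes P: "primeideal P R" and SP: "S \<subseteq> P"
  shows "\<exists>Q. primeideal Q R \<and> S \<subseteq> Q \<and> Q \<subseteq> P \<and>
    (\<forall>Q'. primeideal Q' R \<and> S \<subseteq> Q' \<and> Q' \<subseteq> Q \<longrightarrow> Q' = Q)"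
proof -
  let ?A = "{Q. primeideal Q R \<and> S \<subseteq> Q \<and> Q \<subseteq> P}"
  let ?le = "\<lambda>X Y :: 'a set. Y \<subseteq> X"
  have "\<exists>M\<in>?A. \<forall>a\<in>?A. ?le M a \<longrightarrow> a = M"
  proof (rule predicate_Zorn)
    show "partial_order_on ?A (relation_of ?le ?A)"
      by (rule partial_order_on_relation_ofI) auto
  next
    fix C assume C: "C \<in> Chains (relation_of ?le ?A)"
    have sub: "C \<subseteq> ?A"
      using C by (rule Chains_relation_of)
    have total: "X \<subseteq> Y \<or> Y \<subseteq> X" if "X \<in> C" "Y \<in> C" for X Y
      using C that unfolding Chains_def relation_of_def by blast
    show "\<exists>u\<in>?A. \<forall>a\<in>C. ?le a u"
    proof (cases "C = {}")
      case True
      then show ?thesis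
        using assms by blast
    next
      case False
      then obtain Q0 where Q0: "Q0 \<in> C"
        by blast
      have pr: "primeideal X R" if "X \<in> C" for X
        using sub that by blast
      have id: "ideal X R" if "X \<in> C" for X
        using pr[OF that] by (rule primeideal.axioms)
      have "primeideal (\<Inter>C) R"
      proof (rule primeidealI)
        show "ideal (\<Inter>C) R"
          unfolding ideal_iff
        proof (intro conjI ballI)
          show "\<Inter>C \<subseteq> carrier R"
            using id[OF Q0] Q0 unfolding ideal_iff by blast
        qed (use id in \<open>unfold ideal_iff, blast\<close>)+
        show "cring R"
          by (rule is_cring)
        show "carrier R \<noteq> \<Inter>C"
        proof
          assume "carrier R = \<Inter>C"
          then have "carrier R \<subseteq> Q0"
            using Q0 by blast
          then show False
            using primeideal.I_notcarr[OF pr[OF Q0]] id[OF Q0] unfolding ideal_iff by blast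
        qed
        show "a \<in> \<Inter>C \<or> b \<in> \<Inter>C" if ab: "a \<in> carrier R" "b \<in> carrier R" "a \<otimes> b \<in> \<Inter>C" for a b
        proof (rule ccontr)
          assume "\<not> ?thesis"
          then obtain X Y where XY: "X \<in> C" "a \<notin> X" "Y \<in> C" "b \<notin> Y"
            by blast
          then obtain Z where "Z \<in> C" "a \<notin> Z" "b \<notin> Z"
            using total[OF XY(1,3)] by blast
          then show False
            using primeideal.I_prime[OF pr ab(1,2)] ab(3) by blast
        qed
      qed
      then show ?thesis
        using sub Q0 by blast
    qed
  qed
  then obtain M where M: "M \<in> ?A" and min: "\<And>X. X \<in> ?A \<Longrightarrow> X \<subseteq> M \<Longrightarrow> X = M"
    by auto
  \<comment> \<open>A prime inside \<open>M\<close> is also inside \<open>P\<close>, so minimality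
    between \<open>S\<close> and \<open>P\<close> is minimality among all primes containing
    \<open>S\<close>.\<close>
  then show ?thesis
    by (intro exI[of _ M]) (use order_trans in blast)
qed


section \<open>Ideals and prime ideals of a Pruefer domain inside its quotient field\<close>

locale pruefer = field K for K (structure) +
  fixes D
  assumes pruefer: "pruefer_domain K D"
begin

abbreviation (input) loc where "loc Q \<equiv> localization_at K D Q"

lemma subring_D: "subring D K"
  using pruefer
  unfolding pruefer_domain_def is_quotient_field_def subdomain_def subcring_def by blast

lemmas D_closed [simp, intro] = subringE(2,3,6,7)[OF subring_D]

lemma D_carrier [simp, intro]: "x \<in> D \<Longrightarrow> x \<in> carrier K"
  using subringE(1)[OF subring_D] by blast

lemma D_pow_closed [simp, intro]: "x \<in> D \<Longrightarrow> x [^] (n::nat) \<in> D"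
  by (induction n) auto

lemma cring_D: "cring (K\<lparr>carrier := D\<rparr>)"
  using subdomain_is_domain pruefer
  unfolding pruefer_domain_def is_quotient_field_def domain_def by blast

lemmas ideal_D_iff = ideal_of_subring_iff[OF subring_D]

lemma Spec_iff:
  "Q \<in> Spec K D \<longleftrightarrow> ideal Q (K\<lparr>carrier := D\<rparr>) \<and> \<one> \<notin> Q \<and>
    (\<forall>a\<in>D. \<forall>b\<in>D. a \<otimes> b \<in> Q \<longrightarrow> a \<in> Q \<or> b \<in> Q)"
proof
  assume "Q \<in> Spec K D"
  then have p: "primeideal Q (K\<lparr>carrier := D\<rparr>)"
    by (simp add: Spec_def)
  then have i: "ideal Q (K\<lparr>carrier := D\<rparr>)"
    by (rule primeideal.axioms)
  have "\<one> \<notin> Q"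
    using ideal.one_imp_carrier[OF i] primeideal.I_notcarr[OF p] by auto
  then show "ideal Q (K\<lparr>carrier := D\<rparr>) \<and> \<one> \<notin> Q \<and>
    (\<forall>a\<in>D. \<forall>b\<in>D. a \<otimes> b \<in> Q \<longrightarrow> a \<in> Q \<or> b \<in> Q)"
    using i primeideal.I_prime[OF p] by auto
next
  assume "ideal Q (K\<lparr>carrier := D\<rparr>) \<and> \<one> \<notin> Q \<and>
    (\<forall>a\<in>D. \<forall>b\<in>D. a \<otimes> b \<in> Q \<longrightarrow> a \<in> Q \<or> b \<in> Q)"
  then have i: "ideal Q (K\<lparr>carrier := D\<rparr>)" and one: "\<one> \<notin> Q"
    and pr: "\<And>a b. a \<in> D \<Longrightarrow> b \<in> D \<Longrightarrow> a \<otimes> b \<in> Q \<Longrightarrow> a \<in> Q \<or> b \<in> Q"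
    by blast+
  have "primeideal Q (K\<lparr>carrier := D\<rparr>)"
  proof (rule primeidealI[OF i cring_D])
    show "carrier (K\<lparr>carrier := D\<rparr>) \<noteq> Q"
      using one D_closed(2) by auto
  qed (use pr in simp)
  then show "Q \<in> Spec K D"
    by (simp add: Spec_def)
qed

lemma ideal_D_closed:
  assumes "ideal I (K\<lparr>carrier := D\<rparr>)"
  shows "x \<in> I \<Longrightarrow> x \<in> D" and "\<zero> \<in> I"
    and "x \<in> I \<Longrightarrow> y \<in> I \<Longrightarrow> x \<oplus> y \<in> I"
    and "x \<in> I \<Longrightarrow> d \<in> D \<Longrightarrow> x \<otimes> d \<in> I"
    and "x \<in> I \<Longrightarrow> d \<in> D \<Longrightarrow> d \<otimes> x \<in> I"
proof -
  note I = assms[unfolded ideal_D_iff]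
  show D: "x \<in> I \<Longrightarrow> x \<in> D" and r: "x \<in> I \<Longrightarrow> d \<in> D \<Longrightarrow> x \<otimes> d \<in> I"
    and "\<zero> \<in> I" and "x \<in> I \<Longrightarrow> y \<in> I \<Longrightarrow> x \<oplus> y \<in> I"
    using I by blast+
  show "x \<in> I \<Longrightarrow> d \<in> D \<Longrightarrow> d \<otimes> x \<in> I"
    using D r m_comm[of x d] by simp
qed

lemma Spec_ideal: "Q \<in> Spec K D \<Longrightarrow> ideal Q (K\<lparr>carrier := D\<rparr>)"
  and one_notin_Spec: "Q \<in> Spec K D \<Longrightarrow> \<one> \<notin> Q"
  and Spec_prime: "Q \<in> Spec K D \<Longrightarrow> a \<otimes> b \<in> Q \<Longrightarrow> a \<in> D \<Longrightarrow> b \<in> D \<Longrightarrow> a \<in> Q \<or> b \<in> Q"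
  using Spec_iff by blast+

lemma Spec_pow:
  assumes "Q \<in> Spec K D" "x \<in> D" "x [^] (n::nat) \<in> Q"
  shows "x \<in> Q"
  using assms(3)
proof (induction n)
  case 0
  then show ?case
    using one_notin_Spec[OF assms(1)] by simp
next
  case (Suc n)
  then show ?case
    using Spec_prime[OF assms(1), of "x [^] n" x] assms(2) by auto
qed

lemma proper_ideal_imp_Spec:
  assumes "ideal I (K\<lparr>carrier := D\<rparr>)" "\<one> \<notin> I"
  shows "\<exists>Q\<in>Spec K D. I \<subseteq> Q"
  using cring.proper_ideal_imp_prime[OF cring_D assms(1)] assms(2) by (auto simp: Spec_def)

lemma exists_minimal_primes_below:
  assumes "Q \<in> Spec K D" "I \<subseteq> Q"
  shows "\<exists>M\<in>minimal_primes K D I. M \<subseteq> Q"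
proof -
  have "primeideal Q (K\<lparr>carrier := D\<rparr>)"
    using assms(1) by (simp add: Spec_def)
  from cring.exists_minimal_prime_below[OF cring_D this assms(2)]
  obtain M where M: "primeideal M (K\<lparr>carrier := D\<rparr>)" "I \<subseteq> M" "M \<subseteq> Q"
    and min: "\<forall>Q'. primeideal Q' (K\<lparr>carrier := D\<rparr>) \<and> I \<subseteq> Q' \<and> Q' \<subseteq> M \<longrightarrow> Q' = M"
    by (elim exE conjE)
  have "M \<in> minimal_primes K D I"
    unfolding minimal_primes_def primes_containing_def Spec_def using M min by simp
  then show ?thesis
    using M(3) by blast
qed

lemma Idl_D:
  assumes "A \<subseteq> D"
  shows "ideal (Idl\<^bsub>K\<lparr>carrier := D\<rparr>\<^esub> A) (K\<lparr>carrier := D\<rparr>)"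
    and "A \<subseteq> Idl\<^bsub>K\<lparr>carrier := D\<rparr>\<^esub> A"
    and "ideal I (K\<lparr>carrier := D\<rparr>) \<Longrightarrow> A \<subseteq> I \<Longrightarrow> Idl\<^bsub>K\<lparr>carrier := D\<rparr>\<^esub> A \<subseteq> I"
proof -
  have r: "ring (K\<lparr>carrier := D\<rparr>)"
    by (rule subring_is_ring[OF subring_D])
  show "ideal (Idl\<^bsub>K\<lparr>carrier := D\<rparr>\<^esub> A) (K\<lparr>carrier := D\<rparr>)"
    and "A \<subseteq> Idl\<^bsub>K\<lparr>carrier := D\<rparr>\<^esub> A"
    and "ideal I (K\<lparr>carrier := D\<rparr>) \<Longrightarrow> A \<subseteq> I \<Longrightarrow> Idl\<^bsub>K\<lparr>carrier := D\<rparr>\<^esub> A \<subseteq> I"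
    using ring.genideal_ideal[OF r] ring.genideal_self[OF r] ring.genideal_minimal[OF r] assms
    by simp_all
qed

section \<open>Localizations as valuation rings\<close>

text \<open>Clearing the denominator makes membership a statement about products in
  \<open>D\<close>, to which primality of \<open>Q\<close> and conductor ideals apply
  directly.\<close>

lemma localization_iff:
  assumes Q: "Q \<in> Spec K D"
  shows "z \<in> loc Q \<longleftrightarrow> z \<in> carrier K \<and> (\<exists>s\<in>D - Q. s \<otimes> z \<in> D)"
proof
  have nz: "s \<noteq> \<zero>" if "s \<in> D - Q" for s
    using that ideal_D_closed(2)[OF Spec_ideal[OF Q]] by auto
  have unit: "inv s \<in> carrier K" "s \<otimes> inv s = \<one>" if "s \<in> D - Q" for s
    using nz[OF that] that field_Units by auto
  show "z \<in> carrier K \<and> (\<exists>s\<in>D - Q. s \<otimes> z \<in> D)" if "z \<in> loc Q"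
  proof -
    obtain a s where z: "z = a \<otimes> inv s" "a \<in> D" "s \<in> D - Q"
      using \<open>z \<in> loc Q\<close> unfolding localization_at_def by blast
    have "s \<otimes> z = a"
      using z unit[OF z(3)] by (simp add: m_lcomm)
    then show ?thesis
      using z unit[OF z(3)] by (intro conjI bexI[of _ s]) auto
  qed
  show "z \<in> loc Q" if z: "z \<in> carrier K \<and> (\<exists>s\<in>D - Q. s \<otimes> z \<in> D)"
  proof -
    obtain s where s: "s \<in> D - Q" "s \<otimes> z \<in> D"
      using z by blast
    have "z = (s \<otimes> z) \<otimes> inv s"
      using s z unit[OF s(1)] m_assoc[of z s "inv s"] by (simp add: m_comm[of s z])
    then show ?thesis
      using s unfolding localization_at_def by blast
  qed
qed

lemma subring_loc: "Q \<in> Spec K D \<Longrightarrow> subring (loc Q) K"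
  using pruefer
  unfolding pruefer_domain_def valuation_domain_def is_quotient_field_def subdomain_def subcring_def
  by blast

lemma loc_closed:
  assumes "Q \<in> Spec K D"
  shows "x \<in> loc Q \<Longrightarrow> x \<in> carrier K" and "x \<in> D \<Longrightarrow> x \<in> loc Q"
    and "x \<in> loc Q \<Longrightarrow> y \<in> loc Q \<Longrightarrow> x \<oplus> y \<in> loc Q"
    and "x \<in> loc Q \<Longrightarrow> y \<in> loc Q \<Longrightarrow> x \<otimes> y \<in> loc Q"
    and "x \<in> loc Q \<Longrightarrow> x [^] (n::nat) \<in> loc Q"
proof -
  note V = subringE[OF subring_loc[OF assms]]
  show "x \<in> loc Q \<Longrightarrow> x \<in> carrier K"
    using V(1) by blast
  show "x \<in> D \<Longrightarrow> x \<in> loc Q"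
    using localization_iff[OF assms] one_notin_Spec[OF assms] by (auto intro!: bexI[of _ \<one>])
  show "x \<in> loc Q \<Longrightarrow> x [^] (n::nat) \<in> loc Q"
    by (induction n) (use V(3,6) in auto)
  show "x \<in> loc Q \<Longrightarrow> y \<in> loc Q \<Longrightarrow> x \<oplus> y \<in> loc Q"
    and "x \<in> loc Q \<Longrightarrow> y \<in> loc Q \<Longrightarrow> x \<otimes> y \<in> loc Q"
    using V(6,7) by simp_all
qed

text \<open>The valuation property in the form of divisibility: for nonzero elements
  \<open>v\<close> is \<open>x / y\<close> or its inverse. The form also covers zero, which is a
  multiple of anything with \<open>v = \<zero>\<close>.\<close>

lemma loc_comparable:
  assumes "Q \<in> Spec K D" "x \<in> carrier K" "y \<in> carrier K"
  obtains v where "v \<in> loc Q" "x = y \<otimes> v" | v where "v \<in> loc Q" "y = x \<otimes> v"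
proof (cases "x = \<zero> \<or> y = \<zero>")
  case True
  then show ?thesis
    using that(1)[of \<zero>] that(2)[of \<zero>] assms loc_closed(2)[OF assms(1) D_closed(1)] by auto
next
  case False
  have unit: "x \<in> Units K" "y \<in> Units K"
    using False assms field_Units by auto
  let ?q = "x \<otimes> inv y"
  have "?q \<otimes> (y \<otimes> inv x) = (x \<otimes> inv x) \<otimes> (y \<otimes> inv y)"
    using unit assms by (simp only: m_ac Units_inv_closed m_closed)
  then have q: "?q \<in> Units K" "inv ?q = y \<otimes> inv x"
    using unit assms by (auto intro!: comm_inv_char)
  have "?q \<in> loc Q \<or> inv ?q \<in> loc Q"
    using pruefer q(1) field_Units assms(1)
    unfolding pruefer_domain_def valuation_domain_def by auto
  moreover have "x = y \<otimes> ?q" "y = x \<otimes> inv ?q"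
    using unit assms q(2) by (auto simp: m_lcomm[of x y] m_lcomm[of y x])
  ultimately show ?thesis
    using that by blast
qed

text \<open>The conductor of \<open>z\<close> into \<open>D\<close>. It is proper when
  \<open>z\<close> is outside \<open>D\<close>, and it contains a finitely generated ideal as soon
  as it contains the generators.\<close>

lemma ideal_conductor:
  assumes z: "z \<in> carrier K"
  shows "ideal {d \<in> D. d \<otimes> z \<in> D} (K\<lparr>carrier := D\<rparr>)"
  unfolding ideal_D_iff
proof (intro conjI ballI)
  let ?I = "{d \<in> D. d \<otimes> z \<in> D}"
  show "x \<oplus> y \<in> ?I" if "x \<in> ?I" "y \<in> ?I" for x y
    using that z by (auto simp: l_distr)
  show "x \<otimes> t \<in> ?I" if "x \<in> ?I" "t \<in> D" for x t
  proof -
    have "x \<otimes> t \<otimes> z = x \<otimes> z \<otimes> t"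
      using that z by (auto simp: m_ac)
    then show ?thesis
      using that by auto
  qed
qed (use z in auto)

text \<open>\<open>D\<close> is the intersection of its localizations. For \<open>z\<close> outside
  \<open>D\<close> the conductor lies in some prime \<open>Q\<close>, whereas
  \<open>z \<in> loc Q\<close> provides a denominator outside \<open>Q\<close>.\<close>

lemma mem_D_if_locally:
  assumes z: "z \<in> carrier K" and loc: "\<And>Q. Q \<in> Spec K D \<Longrightarrow> z \<in> loc Q"
  shows "z \<in> D"
proof (rule ccontr)
  assume nD: "z \<notin> D"
  let ?I = "{d \<in> D. d \<otimes> z \<in> D}"
  have "ideal ?I (K\<lparr>carrier := D\<rparr>)"
    using ideal_conductor[OF z] .
  moreover have "\<one> \<notin> ?I"
    using nD z by simp
  ultimately obtain Q where "Q \<in> Spec K D" "?I \<subseteq> Q"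
    using proper_ideal_imp_Spec by blast
  then show False
    using loc localization_iff by blast
qed

section \<open>Uniform bounds on powers in a localization\<close>

text \<open>
  For \<open>p \<noteq> \<zero>\<close> this says that \<open>c\<close> witnesses almost integrality of \<open>w / p\<close> over the localization
  at \<open>Q\<close>; stated without division, it also makes sense for \<open>p = \<zero>\<close>.
\<close>

definition power_bounded :: "'a set \<Rightarrow> 'a \<Rightarrow> 'a \<Rightarrow> 'a \<Rightarrow> bool" where
  "power_bounded Q c w p \<longleftrightarrow> (\<forall>n::nat. \<exists>v\<in>loc Q. c \<otimes> w [^] n = p [^] n \<otimes> v)"

lemma power_bounded_one_iff:
  assumes "Q \<in> Spec K D" "c \<in> carrier K" "w \<in> carrier K"
  shows "power_bounded Q c w \<one> \<longleftrightarrow> (\<forall>n::nat. c \<otimes> w [^] n \<in> loc Q)"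
  using loc_closed(1)[OF assms(1)] by (auto simp: power_bounded_def)

text \<open>The two bounds multiply. Multiplication by an almost integral element, by an element of
  \<open>D\<close>, or by a factor \<open>\<one> \<oplus> v\<close> from the valuation ring are all
  instances.\<close>

lemma power_bounded_mult:
  assumes Q: "Q \<in> Spec K D"
    and [simp]: "c \<in> carrier K" "d \<in> carrier K" "w \<in> carrier K" "t \<in> carrier K" "p \<in> carrier K"
    and w: "power_bounded Q c w p" and t: "power_bounded Q d t \<one>"
  shows "power_bounded Q (c \<otimes> d) (w \<otimes> t) p"
  unfolding power_bounded_def
proof
  fix n :: nat
  obtain v where v: "v \<in> loc Q" "c \<otimes> w [^] n = p [^] n \<otimes> v"
    using w unfolding power_bounded_def by blast
  have u: "d \<otimes> t [^] n \<in> loc Q"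
    using t power_bounded_one_iff[OF Q] by simp
  have [simp]: "v \<in> carrier K"
    using v loc_closed(1)[OF Q] by blast
  have "(c \<otimes> d) \<otimes> (w \<otimes> t) [^] n = (c \<otimes> w [^] n) \<otimes> (d \<otimes> t [^] n)"
    by (simp add: nat_pow_distrib m_ac)
  also have "\<dots> = p [^] n \<otimes> (v \<otimes> (d \<otimes> t [^] n))"
    unfolding v(2) by (simp add: m_assoc)
  finally show "\<exists>v\<in>loc Q. c \<otimes> d \<otimes> (w \<otimes> t) [^] n = p [^] n \<otimes> v"
    using loc_closed(4)[OF Q v(1) u] by blast
qed

text \<open>In the valuation ring one summand divides the other, so the sum is the dividing summand
  times some \<open>\<one> \<oplus> v\<close> and inherits its bound. The product
  \<open>c \<otimes> d\<close> is used in both cases, which keeps the constant independent of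
  \<open>Q\<close>.\<close>

lemma power_bounded_add:
  assumes Q: "Q \<in> Spec K D"
    and c: "c \<in> D" "d \<in> D"
    and K: "w \<in> carrier K" "t \<in> carrier K" "p \<in> carrier K" "q \<in> carrier K"
    and w: "power_bounded Q c w p" and t: "power_bounded Q d t q"
  shows "power_bounded Q (c \<otimes> d) (w \<oplus> t) p \<or> power_bounded Q (c \<otimes> d) (w \<oplus> t) q"
proof -
  \<comment> \<open>Powers of \<open>\<one> \<oplus> v\<close> stay in the valuation ring, so any
    constant from \<open>D\<close> bounds them; the constant of the other summand can be
    taken.\<close>
  have bd: "power_bounded Q e (\<one> \<oplus> v) \<one>" if "e \<in> D" "v \<in> loc Q" for e v
  proof -
    note V = loc_closed[OF Q]
    have "\<one> \<oplus> v \<in> loc Q"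
      using that V(2,3) by simp
    then show ?thesis
      using that V power_bounded_one_iff[OF Q] by auto
  qed
  show ?thesis
  proof (rule loc_comparable[OF Q K(1,2)])
    fix v assume v: "v \<in> loc Q" "w = t \<otimes> v"
    then have vK: "v \<in> carrier K"
      using loc_closed(1)[OF Q] by blast
    have "power_bounded Q (d \<otimes> c) (t \<otimes> (\<one> \<oplus> v)) q"
      using vK c K by (intro power_bounded_mult[OF Q _ _ _ _ _ t bd] v) auto
    moreover have "t \<otimes> (\<one> \<oplus> v) = w \<oplus> t"
      using vK K v by (simp add: r_distr a_comm)
    ultimately show ?thesis
      using c by (simp add: m_comm)
  next
    fix v assume v: "v \<in> loc Q" "t = w \<otimes> v"
    then have vK: "v \<in> carrier K"
      using loc_closed(1)[OF Q] by blast
    have "power_bounded Q (c \<otimes> d) (w \<otimes> (\<one> \<oplus> v)) p"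
      using vK c K by (intro power_bounded_mult[OF Q _ _ _ _ _ w bd] v) auto
    moreover have "w \<otimes> (\<one> \<oplus> v) = w \<oplus> t"
      using vK K v by (simp add: r_distr)
    ultimately show ?thesis
      by simp
  qed
qed

section \<open>The complete integral closure and extension of ideals to it\<close>

text \<open>Almost integrality can be tested locally provided that one \<open>c\<close> serves all
  primes; \<open>mem_D_if_locally\<close> leads back from the localizations to
  \<open>D\<close>.\<close>

lemma complete_integral_closure_iff:
  "z \<in> complete_integral_closure K D \<longleftrightarrow>
    z \<in> carrier K \<and> (\<exists>c\<in>D - {\<zero>}. \<forall>Q\<in>Spec K D. power_bounded Q c z \<one>)"
proof -
  have "(\<forall>n::nat. n > 0 \<longrightarrow> c \<otimes> z [^] n \<in> D) \<longleftrightarrow> (\<forall>Q\<in>Spec K D. power_bounded Q c z \<one>)"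
    if z: "z \<in> carrier K" and c: "c \<in> D" for c
  proof
    assume pos: "\<forall>n::nat. n > 0 \<longrightarrow> c \<otimes> z [^] n \<in> D"
    \<comment> \<open>\<open>power_bounded\<close> includes exponent 0, where the element in
      question is \<open>c\<close> itself.\<close>
    have "c \<otimes> z [^] n \<in> D" for n :: nat
      using pos c by (cases n) auto
    then show "\<forall>Q\<in>Spec K D. power_bounded Q c z \<one>"
      using power_bounded_one_iff z c loc_closed(2) by blast
  next
    assume "\<forall>Q\<in>Spec K D. power_bounded Q c z \<one>"
    then show "\<forall>n::nat. n > 0 \<longrightarrow> c \<otimes> z [^] n \<in> D"
      using power_bounded_one_iff z c by (auto intro!: mem_D_if_locally)
  qed
  then show ?thesis
    unfolding complete_integral_closure_def almost_integral_def by auto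
qed

lemma D_subset_complete_integral_closure: "D \<subseteq> complete_integral_closure K D"
proof
  fix x assume x: "x \<in> D"
  then have "\<forall>Q\<in>Spec K D. power_bounded Q \<one> x \<one>"
    using power_bounded_one_iff loc_closed(2) by auto
  then show "x \<in> complete_integral_closure K D"
    using x complete_integral_closure_iff by (auto intro!: bexI[of _ \<one>])
qed

text \<open>The product of two witnesses is a witness for both the sum and the product, by the local
  bounds with \<open>p = q = \<one>\<close>.\<close>

lemma subring_complete_integral_closure: "subring (complete_integral_closure K D) K"
proof -
  let ?T = "complete_integral_closure K D"
  have T: "x \<oplus> y \<in> ?T \<and> x \<otimes> y \<in> ?T" if "x \<in> ?T" "y \<in> ?T" for x y
  proof -
    obtain c where c: "x \<in> carrier K" "c \<in> D" "c \<noteq> \<zero>" "\<forall>Q\<in>Spec K D. power_bounded Q c x \<one>"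
      using \<open>x \<in> ?T\<close> by (auto simp: complete_integral_closure_iff)
    obtain d where d: "y \<in> carrier K" "d \<in> D" "d \<noteq> \<zero>" "\<forall>Q\<in>Spec K D. power_bounded Q d y \<one>"
      using \<open>y \<in> ?T\<close> by (auto simp: complete_integral_closure_iff)
    have "c \<otimes> d \<in> D - {\<zero>}"
      using c d integral_iff by auto
    moreover have "power_bounded Q (c \<otimes> d) (x \<oplus> y) \<one>"
      and "power_bounded Q (c \<otimes> d) (x \<otimes> y) \<one>" if Q: "Q \<in> Spec K D" for Q
    proof -
      have b: "power_bounded Q c x \<one>" "power_bounded Q d y \<one>"
        using c d Q by blast+
      show "power_bounded Q (c \<otimes> d) (x \<oplus> y) \<one>"
        using power_bounded_add[OF Q c(2) d(2) c(1) d(1) _ _ b] by simp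
      show "power_bounded Q (c \<otimes> d) (x \<otimes> y) \<one>"
        using power_bounded_mult[OF Q _ _ c(1) d(1) _ b] c(2) d(2) by simp
    qed
    moreover have "x \<oplus> y \<in> carrier K" "x \<otimes> y \<in> carrier K"
      using c d by auto
    ultimately show ?thesis
      unfolding complete_integral_closure_iff by meson
  qed
  have one: "\<one> \<in> ?T" "\<ominus> \<one> \<in> ?T"
    using D_subset_complete_integral_closure subringE(3,5)[OF subring_D] by blast+
  show ?thesis
  proof (rule subringI)
    show sub: "?T \<subseteq> carrier K"
      using complete_integral_closure_iff by blast
    show "\<ominus> h \<in> ?T" if "h \<in> ?T" for h
      using T[OF one(2) that] that sub by (auto simp: l_minus)
  qed (use T one in blast)+
qed

text \<open>No expansion of \<open>w\<close> as a finite sum is chosen. The elements admitting such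
  \<open>A\<close> and \<open>c\<close> form an ideal \<open>E\<close> of the complete integral
  closure that contains \<open>P\<close>, hence contains the extension. Both \<open>A\<close> and
  \<open>c\<close> are uniform; only \<open>p\<close> varies with \<open>Q\<close>.\<close>

lemma power_bounded_if_mem_extended_ideal:
  assumes P: "ideal P (K\<lparr>carrier := D\<rparr>)"
    and w: "w \<in> extended_ideal K (complete_integral_closure K D) P"
  obtains A c where "finite A" "A \<subseteq> P" "c \<in> D" "c \<noteq> \<zero>"
    and "\<forall>Q\<in>Spec K D. \<exists>p\<in>A. power_bounded Q c w p"
proof -
  let ?T = "complete_integral_closure K D"
  let ?ok = "\<lambda>w A c. finite A \<and> A \<subseteq> P \<and> c \<in> D \<and> c \<noteq> \<zero> \<and>
    (\<forall>Q\<in>Spec K D. \<exists>p\<in>A. power_bounded Q c w p)"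
  define E where "E = {w \<in> ?T. \<exists>A c. ?ok w A c}"
  note T = subringE[OF subring_complete_integral_closure]
  have PK: "p \<in> carrier K" if "p \<in> P" for p
    using ideal_D_closed(1)[OF P that] by simp
  have PE: "P \<subseteq> E"
  proof
    fix w assume w: "w \<in> P"
    have "power_bounded Q \<one> w w" if "Q \<in> Spec K D" for Q
      unfolding power_bounded_def
    proof
      fix n :: nat
      have "\<one> \<otimes> w [^] n = w [^] n \<otimes> \<one>"
        using PK[OF w] by simp
      then show "\<exists>v\<in>loc Q. \<one> \<otimes> w [^] n = w [^] n \<otimes> v"
        using loc_closed(2)[OF that] D_closed(2) by blast
    qed
    then have "?ok w {w} \<one>"
      using w by simp
    moreover have "w \<in> ?T"
      using ideal_D_closed(1)[OF P w] D_subset_complete_integral_closure by blast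
    ultimately show "w \<in> E"
      unfolding E_def by blast
  qed
  have "ideal E (K\<lparr>carrier := ?T\<rparr>)"
    unfolding ideal_of_subring_iff[OF subring_complete_integral_closure]
  proof (intro conjI ballI)
    show "E \<subseteq> ?T"
      by (auto simp: E_def)
    show "\<zero> \<in> E"
      using PE ideal_D_closed(2)[OF P] by blast
  next
    fix x y assume "x \<in> E" "y \<in> E"
    then obtain A c B d where x: "x \<in> ?T" "?ok x A c" and y: "y \<in> ?T" "?ok y B d"
      by (auto simp: E_def)
    have "x \<in> carrier K" "y \<in> carrier K"
      using x(1) y(1) T(1) by blast+
    \<comment> \<open>Which of \<open>p\<close> and \<open>q\<close> bounds the sum depends on
      \<open>Q\<close>, so both sets are kept.\<close>
    have "\<exists>p\<in>A \<union> B. power_bounded Q (c \<otimes> d) (x \<oplus> y) p" if Q: "Q \<in> Spec K D" for Q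
    proof -
      obtain p where p: "p \<in> A" "power_bounded Q c x p"
        using x(2) Q by blast
      obtain q where q: "q \<in> B" "power_bounded Q d y q"
        using y(2) Q by blast
      have "p \<in> carrier K" "q \<in> carrier K"
        using PK p(1) q(1) x(2) y(2) by blast+
      with power_bounded_add[OF Q _ _ \<open>x \<in> carrier K\<close> \<open>y \<in> carrier K\<close> _ _ p(2) q(2)]
      show ?thesis
        using p(1) q(1) x(2) y(2) by blast
    qed
    then have "?ok (x \<oplus> y) (A \<union> B) (c \<otimes> d)"
      using x(2) y(2) integral_iff by auto
    then show "x \<oplus> y \<in> E"
      using T(7)[OF x(1) y(1)] unfolding E_def by blast
  next
    fix x t assume "x \<in> E" "t \<in> ?T"
    then obtain A c where x: "x \<in> ?T" "?ok x A c"
      by (auto simp: E_def)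
    obtain d where d: "t \<in> carrier K" "d \<in> D" "d \<noteq> \<zero>" "\<forall>Q\<in>Spec K D. power_bounded Q d t \<one>"
      using \<open>t \<in> ?T\<close> by (auto simp: complete_integral_closure_iff)
    have "x \<in> carrier K"
      using x(1) T(1) by blast
    have "\<exists>p\<in>A. power_bounded Q (c \<otimes> d) (x \<otimes> t) p" if Q: "Q \<in> Spec K D" for Q
    proof -
      obtain p where p: "p \<in> A" "power_bounded Q c x p"
        using x(2) Q by blast
      have "power_bounded Q d t \<one>"
        using d(4) Q by blast
      moreover have "p \<in> carrier K" "c \<in> carrier K" "d \<in> carrier K"
        using PK p(1) x(2) d(2) by auto
      ultimately show ?thesis
        using power_bounded_mult[OF Q _ _ \<open>x \<in> carrier K\<close> d(1) _ p(2)] p(1) by blast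
    qed
    then have "?ok (x \<otimes> t) A (c \<otimes> d)"
      using x(2) d(2,3) integral_iff by auto
    then show "x \<otimes> t \<in> E"
      using T(6)[OF x(1) \<open>t \<in> ?T\<close>] unfolding E_def by blast
  qed
  then have "extended_ideal K ?T P \<subseteq> E"
    using PE by (auto simp: extended_ideal_def genideal_def)
  then have "w \<in> E"
    using w by blast
  then show ?thesis
    using that unfolding E_def by blast
qed

section \<open>From \<open>P \<notin> Spec_star K D\<close> to ideals without a common minimal
  prime\<close>

text \<open>The bound says that \<open>d\<close> lies in every \<open>p [^] n\<close> times
  \<open>loc Q\<close>. The elements of \<open>D\<close> with this property form \<open>Q'\<close>.
  If \<open>a\<close> and \<open>b\<close> are not in \<open>Q'\<close>, then by comparability
  \<open>a\<close> divides some \<open>p [^] m\<close> and \<open>b\<close> some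
  \<open>p [^] k\<close>, so \<open>a \<otimes> b\<close> divides \<open>p [^] (m + k)\<close> in
  \<open>loc Q\<close>, and cannot itself be a multiple of all powers of the non-unit
  \<open>p\<close>.\<close>

lemma exists_Spec_below_if_power_bounded_one:
  assumes Q: "Q \<in> Spec K D" and p: "p \<in> Q"
    and d: "d \<in> D" "d \<noteq> \<zero>" "power_bounded Q d \<one> p"
  shows "\<exists>Q'\<in>Spec K D. d \<in> Q' \<and> Q' \<subset> Q"
proof -
  note V = loc_closed[OF Q]
  note IQ = ideal_D_closed[OF Spec_ideal[OF Q]]
  have pD: "p \<in> D"
    using IQ(1) p .
  have [simp]: "p \<in> carrier K"
    using pD by simp
  have pb: "power_bounded Q a \<one> p \<longleftrightarrow> (\<forall>n::nat. \<exists>v\<in>loc Q. a = p [^] n \<otimes> v)" if "a \<in> D" for a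
    using that by (simp add: power_bounded_def)
  have p_nz: "p \<noteq> \<zero>"
  proof
    assume p0: "p = \<zero>"
    obtain v where "v \<in> loc Q" "d = p [^] (1::nat) \<otimes> v"
      using d(3) pb[OF d(1)] by blast
    then show False
      using d(2) p0 V(1) by simp
  qed
  have pn_nz: "p [^] n \<noteq> \<zero>" for n :: nat
    using p_nz by (induction n) (simp_all add: integral_iff)
  define Q' where "Q' = {a \<in> D. power_bounded Q a \<one> p}"
  have mem: "a \<in> Q' \<longleftrightarrow> a \<in> D \<and> (\<forall>n::nat. \<exists>v\<in>loc Q. a = p [^] n \<otimes> v)" for a
    using pb by (auto simp: Q'_def)
  \<comment> \<open>An inverse \<open>v\<close> of \<open>p\<close> with denominator
    \<open>s\<close> would give \<open>s = p \<otimes> (s \<otimes> v)\<close>, an element of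
    \<open>Q\<close>.\<close>
  have not_unit: "\<one> \<noteq> p \<otimes> v" if v: "v \<in> loc Q" for v
  proof
    assume 1: "\<one> = p \<otimes> v"
    obtain s where s: "s \<in> D" "s \<notin> Q" "s \<otimes> v \<in> D"
      using v localization_iff[OF Q] by blast
    have "s = s \<otimes> (p \<otimes> v)"
      using s 1[symmetric] by simp
    also have "\<dots> = p \<otimes> (s \<otimes> v)"
      using s V(1)[OF v] by (simp add: m_lcomm)
    finally show False
      using s IQ(4)[OF p s(3)] by simp
  qed
  have cancel: "x = p [^] n \<otimes> (p \<otimes> v) \<Longrightarrow> v \<in> loc Q \<Longrightarrow> x \<noteq> p [^] n" for x v and n :: nat
  proof
    assume x: "x = p [^] n \<otimes> (p \<otimes> v)" "x = p [^] n" and v: "v \<in> loc Q"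
    then have "p [^] n \<otimes> \<one> = p [^] n \<otimes> (p \<otimes> v)"
      by simp
    then have "\<one> = p \<otimes> v"
      using m_lcancel[OF pn_nz, of n \<one> "p \<otimes> v"] V(1)[OF v] by simp
    then show False
      using not_unit[OF v] by blast
  qed
  have sub: "Q' \<subseteq> Q"
  proof
    fix a assume a: "a \<in> Q'"
    then obtain v where v: "v \<in> loc Q" "a = p [^] (1::nat) \<otimes> v"
      unfolding mem by blast
    obtain s where s: "s \<in> D" "s \<notin> Q" "s \<otimes> v \<in> D"
      using v localization_iff[OF Q] by blast
    have "s \<otimes> a = p \<otimes> (s \<otimes> v)"
      using s v V(1)[OF v(1)] by (simp add: m_lcomm)
    then have "s \<otimes> a \<in> Q"
      using IQ(4)[OF p s(3)] by simp
    then show "a \<in> Q"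
      using Spec_prime[OF Q] s a mem by blast
  qed
  \<comment> \<open>Exponent 2 suffices: \<open>p\<close> is no multiple of its square, since it is
    not a unit of \<open>loc Q\<close>.\<close>
  have "p \<notin> Q'"
  proof
    assume "p \<in> Q'"
    then obtain v where v: "v \<in> loc Q" "p = p [^] (2::nat) \<otimes> v"
      unfolding mem by blast
    then have "p = p [^] (1::nat) \<otimes> (p \<otimes> v)"
      using V(1) by (simp add: numeral_2_eq_2 m_assoc)
    then show False
      using cancel[of p 1 v] v(1) by simp
  qed
  moreover have "Q' \<in> Spec K D"
    unfolding Spec_iff
  proof (intro conjI ballI impI)
    show "ideal Q' (K\<lparr>carrier := D\<rparr>)"
      unfolding ideal_D_iff
    proof (intro conjI ballI)
      show "Q' \<subseteq> D"
        by (auto simp: Q'_def)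
      have "\<zero> = p [^] n \<otimes> \<zero>" for n :: nat
        by simp
      then show "\<zero> \<in> Q'"
        unfolding mem using V(2)[OF D_closed(1)] D_closed(1) by blast
    next
      fix x y assume xy: "x \<in> Q'" "y \<in> Q'"
      have "\<exists>v\<in>loc Q. x \<oplus> y = p [^] n \<otimes> v" for n :: nat
      proof -
        obtain u v where "u \<in> loc Q" "x = p [^] n \<otimes> u" "v \<in> loc Q" "y = p [^] n \<otimes> v"
          using xy unfolding mem by meson
        then show ?thesis
          using V(1) V(3)[of u v] by (intro bexI[of _ "u \<oplus> v"]) (auto simp: r_distr)
      qed
      then show "x \<oplus> y \<in> Q'"
        using xy by (simp add: mem)
    next
      fix x t assume xt: "x \<in> Q'" "t \<in> D"
      have "\<exists>v\<in>loc Q. x \<otimes> t = p [^] n \<otimes> v" for n :: nat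
      proof -
        obtain u where "u \<in> loc Q" "x = p [^] n \<otimes> u"
          using xt unfolding mem by meson
        then show ?thesis
          using V(1) V(2)[OF xt(2)] V(4)[of u t]
          by (intro bexI[of _ "u \<otimes> t"]) (auto simp: m_assoc)
      qed
      then show "x \<otimes> t \<in> Q'"
        using xt by (simp add: mem)
    qed
    show "\<one> \<notin> Q'"
      using sub one_notin_Spec[OF Q] by blast
  next
    fix a b assume ab: "a \<in> D" "b \<in> D" "a \<otimes> b \<in> Q'"
    have [simp]: "a \<in> carrier K" "b \<in> carrier K"
      using ab by simp_all
    show "a \<in> Q' \<or> b \<in> Q'"
    proof (rule ccontr)
      assume "\<not> ?thesis"
      then obtain m k :: nat where mk: "\<forall>v\<in>loc Q. a \<noteq> p [^] m \<otimes> v" "\<forall>v\<in>loc Q. b \<noteq> p [^] k \<otimes> v"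
        using ab unfolding mem by meson
      obtain v where v: "v \<in> loc Q" "p [^] m = a \<otimes> v"
        using mk(1) loc_comparable[OF Q, of a "p [^] m"] by auto
      obtain w where w: "w \<in> loc Q" "p [^] k = b \<otimes> w"
        using mk(2) loc_comparable[OF Q, of b "p [^] k"] by auto
      \<comment> \<open>The exponent is one more than \<open>m + k\<close>, which leaves the spare
        factor \<open>p\<close> that \<open>cancel\<close> refutes.\<close>
      obtain u where u: "u \<in> loc Q" "a \<otimes> b = p [^] Suc (m + k) \<otimes> u"
        using ab(3) unfolding mem by meson
      have [simp]: "u \<in> carrier K" "v \<in> carrier K" "w \<in> carrier K"
        using u v w V(1) by auto
      have "p [^] (m + k) = (a \<otimes> v) \<otimes> (b \<otimes> w)"
        by (simp add: nat_pow_mult[symmetric] v(2)[symmetric] w(2)[symmetric])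
      also have "\<dots> = (a \<otimes> b) \<otimes> (v \<otimes> w)"
        by (simp add: m_ac)
      also have "\<dots> = p [^] (m + k) \<otimes> (p \<otimes> (u \<otimes> (v \<otimes> w)))"
        unfolding u(2) by (simp add: m_assoc)
      finally show False
        using cancel[of "p [^] (m + k)" "m + k" "u \<otimes> (v \<otimes> w)"] V(4) u(1) v(1) w(1) by blast
    qed
  qed
  moreover have "d \<in> Q'"
    using d by (simp add: Q'_def)
  ultimately show ?thesis
    using sub p by blast
qed

lemma disjoint_minimal_primes_if_not_Spec_star:
  assumes P: "P \<in> Spec K D" and "P \<notin> Spec_star K D"
  obtains I J where "fin_gen_ideal K D I" "fin_gen_ideal K D J" "{\<zero>} \<noteq> I" "I \<subset> J" "J \<subseteq> P"
    and "minimal_primes K D I \<inter> minimal_primes K D J = {}"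
proof -
  have iP: "ideal P (K\<lparr>carrier := D\<rparr>)"
    using Spec_ideal[OF P] .
  have "\<one> \<in> extended_ideal K (complete_integral_closure K D) P"
    using assms subringE(3)[OF subring_complete_integral_closure] by (simp add: Spec_star_def)
  then obtain A c where A: "finite A" "A \<subseteq> P" and c: "c \<in> D" "c \<noteq> \<zero>"
    and bd: "\<forall>Q\<in>Spec K D. \<exists>p\<in>A. power_bounded Q c \<one> p"
    using power_bounded_if_mem_extended_ideal[OF iP] by blast
  have AD: "A \<subseteq> D"
    using A(2) ideal_D_closed(1)[OF iP] by blast
  \<comment> \<open>An element that bounds at some prime is nonzero, since exponent 1 with
    \<open>\<zero>\<close> would force \<open>c = \<zero>\<close>. The prime \<open>P\<close> is at
    hand.\<close>
  obtain p0 where p0: "p0 \<in> A" "power_bounded P c \<one> p0"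
    using bd P by blast
  have p0D: "p0 \<in> D"
    using p0 AD by blast
  have "p0 \<noteq> \<zero>"
  proof
    assume z: "p0 = \<zero>"
    obtain v where "v \<in> loc P" "c \<otimes> \<one> [^] (1::nat) = p0 [^] (1::nat) \<otimes> v"
      using p0(2) unfolding power_bounded_def by blast
    then show False
      using c z loc_closed(1)[OF P] by simp
  qed
  \<comment> \<open>The factor \<open>p0\<close> puts \<open>d\<close> into \<open>J\<close>, while
    the factor \<open>c\<close> carries the bound at every prime.\<close>
  define d where "d = c \<otimes> p0"
  have d: "d \<in> D" "d \<noteq> \<zero>"
    using c p0D \<open>p0 \<noteq> \<zero>\<close> integral_iff by (auto simp: d_def)
  define I where "I = Idl\<^bsub>K\<lparr>carrier := D\<rparr>\<^esub> {d}"
  define J where "J = Idl\<^bsub>K\<lparr>carrier := D\<rparr>\<^esub> A"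
  have J: "ideal J (K\<lparr>carrier := D\<rparr>)" "A \<subseteq> J" "J \<subseteq> P"
    using Idl_D[OF AD] iP A(2) by (auto simp: J_def)
  have I: "ideal I (K\<lparr>carrier := D\<rparr>)" "d \<in> I"
    and I_min: "\<And>H. ideal H (K\<lparr>carrier := D\<rparr>) \<Longrightarrow> d \<in> H \<Longrightarrow> I \<subseteq> H"
    using Idl_D[of "{d}"] d(1) by (auto simp: I_def)
  have "d \<in> J"
    using ideal_D_closed(5)[OF J(1)] p0(1) J(2) c(1) by (auto simp: d_def)
  then have "I \<subseteq> J"
    using I_min J(1) by blast
  have disj: "minimal_primes K D I \<inter> minimal_primes K D J = {}"
  proof (rule ccontr)
    assume "\<not> ?thesis"
    then obtain Q where QI: "Q \<in> minimal_primes K D I" and QJ: "Q \<in> minimal_primes K D J"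
      by blast
    have Q: "Q \<in> Spec K D" "J \<subseteq> Q"
      using QJ by (auto simp: minimal_primes_def primes_containing_def)
    obtain p where p: "p \<in> A" "power_bounded Q c \<one> p"
      using bd Q(1) by blast
    have pK: "p \<in> carrier K"
      using p(1) AD by blast
    have "power_bounded Q p0 \<one> \<one>"
      using power_bounded_one_iff[OF Q(1)] loc_closed(2)[OF Q(1)] p0D by simp
    then have "power_bounded Q d (\<one> \<otimes> \<one>) p"
      unfolding d_def using p c p0D pK by (intro power_bounded_mult[OF Q(1)]) auto
    then have "power_bounded Q d \<one> p"
      by simp
    then obtain Q' where Q': "Q' \<in> Spec K D" "d \<in> Q'" "Q' \<subset> Q"
      using exists_Spec_below_if_power_bounded_one[OF Q(1) _ d] p(1) J(2) Q(2) by blast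
    then have "I \<subseteq> Q'"
      using I_min Spec_ideal by blast
    then show False
      using QI Q' by (auto simp: minimal_primes_def primes_containing_def)
  qed
  \<comment> \<open>\<open>J\<close> has a minimal prime below \<open>P\<close>, which equal ideals
    would share.\<close>
  have "I \<noteq> J"
    using disj exists_minimal_primes_below[OF P J(3)] by auto
  show ?thesis
  proof (rule that)
    show "fin_gen_ideal K D I"
      using d(1) by (auto simp: fin_gen_ideal_def I_def)
    show "fin_gen_ideal K D J"
      using A(1) AD by (auto simp: fin_gen_ideal_def J_def)
    show "{\<zero>} \<noteq> I"
      using I(2) d(2) by blast
  qed (use disj J(3) \<open>I \<subseteq> J\<close> \<open>I \<noteq> J\<close> in auto)
qed

section \<open>From ideals without a common minimal prime to
  \<open>P \<notin> Spec_star K D\<close>\<close>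

text \<open>A single nonzero \<open>c \<in> I\<close> witnesses almost integrality for every
  \<open>z\<close> in the inverse of \<open>J\<close>. This is checked at each prime
  \<open>Q\<close>, according to whether \<open>Q\<close> contains \<open>J\<close>.\<close>

lemma inverse_ideal_almost_integral:
  assumes I: "ideal I (K\<lparr>carrier := D\<rparr>)" and J: "ideal J (K\<lparr>carrier := D\<rparr>)"
    and IJ: "I \<subseteq> J" "minimal_primes K D I \<inter> minimal_primes K D J = {}"
    and c: "c \<in> I" "c \<noteq> \<zero>"
    and z: "z \<in> carrier K" "\<And>j. j \<in> J \<Longrightarrow> j \<otimes> z \<in> D"
  shows "z \<in> complete_integral_closure K D"
proof -
  have cD: "c \<in> D"
    using ideal_D_closed(1)[OF I c(1)] .
  have "c \<otimes> z [^] n \<in> loc Q" if Q: "Q \<in> Spec K D" for Q and n :: nat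
  proof (cases "J \<subseteq> Q")
    case False
    \<comment> \<open>Here \<open>j\<close> is a denominator for \<open>z\<close> at
      \<open>Q\<close>, so \<open>j [^] n\<close> clears \<open>z [^] n\<close>.\<close>
    then obtain j where j: "j \<in> J" "j \<notin> Q"
      by blast
    have jD: "j \<in> D"
      using ideal_D_closed(1)[OF J j(1)] .
    have "j [^] n \<otimes> (c \<otimes> z [^] n) = c \<otimes> (j \<otimes> z) [^] n"
      using jD cD z(1) by (simp add: nat_pow_distrib m_lcomm)
    also have "\<dots> \<in> D"
      using z(2)[OF j(1)] cD by simp
    finally have "j [^] n \<otimes> (c \<otimes> z [^] n) \<in> D" .
    moreover have "j [^] n \<in> D - Q"
      using Spec_pow[OF Q jD] j(2) jD by auto
    ultimately show ?thesis
      using localization_iff[OF Q] cD z(1) by auto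
  next
    case True
    obtain M where M: "M \<in> minimal_primes K D J" "M \<subseteq> Q"
      using exists_minimal_primes_below[OF Q True] by blast
    have MJ: "M \<in> Spec K D" "J \<subseteq> M"
      and M_min: "\<And>N. N \<in> Spec K D \<Longrightarrow> J \<subseteq> N \<Longrightarrow> N \<subseteq> M \<Longrightarrow> N = M"
      using M(1) by (auto simp: minimal_primes_def primes_containing_def)
    \<comment> \<open>\<open>M\<close> contains \<open>I\<close> but is not minimal over it, so a
      strictly smaller \<open>Q'\<close> contains \<open>I\<close>; minimality of \<open>M\<close>
      over \<open>J\<close> keeps \<open>J\<close> out of \<open>Q'\<close>.\<close>
    have "M \<notin> minimal_primes K D I"
      using IJ(2) M(1) by blast
    then obtain Q' where S: "Q' \<in> Spec K D" and Q': "I \<subseteq> Q'" "Q' \<subseteq> M" "Q' \<noteq> M"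
      using MJ IJ(1) by (auto simp: minimal_primes_def primes_containing_def)
    have "\<not> J \<subseteq> Q'"
      using M_min[OF S] Q' by blast
    then obtain x where x: "x \<in> J" "x \<notin> Q'"
      by blast
    have xD: "x \<in> D"
      using ideal_D_closed(1)[OF J x(1)] .
    have S: "Q' \<in> Spec K D" "c \<in> Q'"
      using S Q'(1) c(1) by auto
    have "c \<in> carrier K" "x [^] n \<in> carrier K"
      using cD xD by auto
    then show ?thesis
    proof (rule loc_comparable[OF Q])
      fix v assume v: "v \<in> loc Q" "c = x [^] n \<otimes> v"
      have "c \<otimes> z [^] n = v \<otimes> (x \<otimes> z) [^] n"
        using v xD z(1) loc_closed(1)[OF Q] by (simp add: nat_pow_distrib m_ac)
      then show ?thesis
        using v(1) z(2)[OF x(1)] loc_closed(2,4,5)[OF Q] by simp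
    next
      \<comment> \<open>This case is contradictory: since \<open>c \<in> Q'\<close>, clearing the
        denominator of \<open>v\<close> would put \<open>s\<close> or \<open>x\<close> into
        \<open>Q'\<close>.\<close>
      fix v assume v: "v \<in> loc Q" "x [^] n = c \<otimes> v"
      then obtain s where s: "s \<in> D" "s \<notin> Q" "s \<otimes> v \<in> D"
        using localization_iff[OF Q] by blast
      have "s \<otimes> x [^] n = c \<otimes> (s \<otimes> v)"
        using s(1) cD v loc_closed(1)[OF Q] by (simp add: m_lcomm)
      then have "s \<otimes> x [^] n \<in> Q'"
        using ideal_D_closed(4)[OF Spec_ideal[OF S(1)] S(2) s(3)] by simp
      then have "s \<in> Q' \<or> x [^] n \<in> Q'"
        using Spec_prime[OF S(1)] s(1) xD by simp
      then show ?thesis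
        using Spec_pow[OF S(1) xD] x(2) s(2) Q'(2) M(2) by blast
    qed
  qed
  then show ?thesis
    using power_bounded_one_iff cD c(2) z(1) unfolding complete_integral_closure_iff by auto
qed

text \<open>Finitely many elements of a valuation ring include one that divides all the others. The
  quotients \<open>b / a\<close> lie in \<open>loc Q\<close>, and \<open>s\<close> is a common
  denominator for them.\<close>

lemma locally_principal:
  assumes Q: "Q \<in> Spec K D" and "finite A" "A \<noteq> {}" "A \<subseteq> D"
  shows "\<exists>a\<in>A. \<exists>s\<in>D - Q. \<forall>b\<in>A. \<exists>r\<in>D. s \<otimes> b = a \<otimes> r"
  using assms(2-)
proof (induction rule: finite_ne_induct)
  case (singleton b)
  then show ?case
    using one_notin_Spec[OF Q] by (auto intro!: bexI[of _ \<one>])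
next
  case (insert b A)
  then obtain a s where a: "a \<in> A" "a \<in> D" and s: "s \<in> D" "s \<notin> Q"
    and r: "\<And>x. x \<in> A \<Longrightarrow> \<exists>r\<in>D. s \<otimes> x = a \<otimes> r"
    by blast
  have b: "b \<in> D" and AD: "A \<subseteq> D"
    using insert.prems by auto
  \<comment> \<open>The new common denominator combines the old \<open>s\<close> with a denominator
    \<open>t\<close> of the quotient that compares \<open>b\<close> and \<open>a\<close>.\<close>
  have st: "s \<otimes> t \<in> D - Q" if "t \<in> D" "t \<notin> Q" for t
    using Spec_prime[OF Q] s that by auto
  have "b \<in> carrier K" "a \<in> carrier K"
    using a b by auto
  then show ?case
  proof (rule loc_comparable[OF Q])
    fix v assume v: "v \<in> loc Q" "b = a \<otimes> v"
    then obtain t where t: "t \<in> D" "t \<notin> Q" "t \<otimes> v \<in> D" and vK: "v \<in> carrier K"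
      using localization_iff[OF Q] by blast
    have "\<exists>r\<in>D. (s \<otimes> t) \<otimes> x = a \<otimes> r" if "x \<in> insert b A" for x
    proof (cases "x = b")
      case True
      have "(s \<otimes> t) \<otimes> b = a \<otimes> (s \<otimes> (t \<otimes> v))"
        using a s t vK v(2) by (simp add: m_ac)
      then show ?thesis
        using True s(1) t(3) by blast
    next
      case False
      then have "x \<in> A"
        using that by blast
      then obtain r where r: "r \<in> D" "s \<otimes> x = a \<otimes> r" and "x \<in> D"
        using r AD by blast
      have "(s \<otimes> t) \<otimes> x = (s \<otimes> x) \<otimes> t"
        using s t \<open>x \<in> D\<close> by (simp add: m_ac)
      also have "\<dots> = a \<otimes> (r \<otimes> t)"
        using r a t by (simp add: m_assoc)
      finally show ?thesis
        using r(1) t(1) by blast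
    qed
    then show ?case
      using a(1) st[OF t(1,2)] by blast
  next
    fix v assume v: "v \<in> loc Q" "a = b \<otimes> v"
    then obtain t where t: "t \<in> D" "t \<notin> Q" "t \<otimes> v \<in> D" and vK: "v \<in> carrier K"
      using localization_iff[OF Q] by blast
    have "\<exists>r\<in>D. (s \<otimes> t) \<otimes> x = b \<otimes> r" if "x \<in> insert b A" for x
    proof (cases "x = b")
      case True
      have "(s \<otimes> t) \<otimes> b = b \<otimes> (s \<otimes> t)"
        using b s t by (simp add: m_comm)
      then show ?thesis
        using True s(1) t(1) by blast
    next
      case False
      then have "x \<in> A"
        using that by blast
      then obtain r where r: "r \<in> D" "s \<otimes> x = a \<otimes> r" and "x \<in> D"
        using r AD by blast
      have "(s \<otimes> t) \<otimes> x = (s \<otimes> x) \<otimes> t"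
        using s t \<open>x \<in> D\<close> by (simp add: m_ac)
      also have "\<dots> = b \<otimes> ((t \<otimes> v) \<otimes> r)"
        unfolding r(2) v(2) using r(1) b t(1) vK by (simp add: m_ac)
      finally show ?thesis
        using r(1) t(3) by blast
    qed
    then show ?case
      using st[OF t(1,2)] by blast
  qed
qed

text \<open>Invertibility of \<open>J\<close> is used at one prime only. If the extension
  \<open>E\<close> of \<open>P\<close> were proper, \<open>E \<inter> D\<close> would lie in a prime
  \<open>M\<close>; local principality of \<open>J\<close> at \<open>M\<close> yields an element of
  \<open>E \<inter> D\<close> outside \<open>M\<close>.\<close>

lemma not_Spec_star_if_disjoint_minimal_primes:
  assumes fg: "fin_gen_ideal K D I" "fin_gen_ideal K D J"
    and IJ: "{\<zero>} \<noteq> I" "I \<subseteq> J" "J \<subseteq> P"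
    and disj: "minimal_primes K D I \<inter> minimal_primes K D J = {}"
  shows "P \<notin> Spec_star K D"
proof
  let ?T = "complete_integral_closure K D"
  assume star: "P \<in> Spec_star K D"
  define E where "E = extended_ideal K ?T P"
  have P: "P \<in> Spec K D" and ne: "E \<noteq> ?T"
    using star by (auto simp: Spec_star_def E_def)
  have PD: "P \<subseteq> D"
    using ideal_D_closed(1)[OF Spec_ideal[OF P]] by blast
  have rT: "ring (K\<lparr>carrier := ?T\<rparr>)"
    using subring_is_ring[OF subring_complete_integral_closure] .
  have PT: "P \<subseteq> carrier (K\<lparr>carrier := ?T\<rparr>)"
    using PD D_subset_complete_integral_closure by simp
  have iE: "ideal E (K\<lparr>carrier := ?T\<rparr>)" and PE: "P \<subseteq> E"
    using ring.genideal_ideal[OF rT PT] ring.genideal_self[OF rT PT]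
    by (simp_all add: E_def extended_ideal_def)
  have "\<one> \<notin> E"
    using ideal.one_imp_carrier[OF iE] ne by auto
  note E = iE[unfolded ideal_of_subring_iff[OF subring_complete_integral_closure]]
  have "ideal (E \<inter> D) (K\<lparr>carrier := D\<rparr>)"
    unfolding ideal_D_iff using E D_subset_complete_integral_closure by auto
  then obtain M where M: "M \<in> Spec K D" "E \<inter> D \<subseteq> M"
    using proper_ideal_imp_Spec \<open>\<one> \<notin> E\<close> by blast
  obtain A where A: "A \<subseteq> D" "finite A" "J = Idl\<^bsub>K\<lparr>carrier := D\<rparr>\<^esub> A"
    using fg(2) by (auto simp: fin_gen_ideal_def)
  have iJ: "ideal J (K\<lparr>carrier := D\<rparr>)" and AJ: "A \<subseteq> J"
    and J_min: "\<And>H. ideal H (K\<lparr>carrier := D\<rparr>) \<Longrightarrow> A \<subseteq> H \<Longrightarrow> J \<subseteq> H"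
    using Idl_D[OF A(1)] A(3) by auto
  have iI: "ideal I (K\<lparr>carrier := D\<rparr>)"
    using fg(1) Idl_D(1) by (auto simp: fin_gen_ideal_def)
  obtain c where c: "c \<in> I" "c \<noteq> \<zero>"
    using IJ(1) ideal_D_closed(2)[OF iI] by blast
  have "ideal {\<zero>} (K\<lparr>carrier := D\<rparr>)"
    unfolding ideal_D_iff by auto
  then have A_nz: "\<not> A \<subseteq> {\<zero>}"
    using J_min c IJ(2) by blast
  then have "A \<noteq> {}"
    by blast
  then obtain a s where a: "a \<in> A" and s: "s \<in> D" "s \<notin> M"
    and r: "\<And>b. b \<in> A \<Longrightarrow> \<exists>r\<in>D. s \<otimes> b = a \<otimes> r"
    using locally_principal[OF M(1) A(2) _ A(1)] by blast
  have aD: "a \<in> D"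
    using a A(1) by blast
  have "s \<noteq> \<zero>"
    using s(2) ideal_D_closed(2)[OF Spec_ideal[OF M(1)]] by blast
  \<comment> \<open>Otherwise \<open>s\<close> would annihilate all generators, although
    \<open>J\<close> contains the nonzero \<open>c\<close>.\<close>
  have "a \<noteq> \<zero>"
  proof
    assume "a = \<zero>"
    then have "s \<otimes> b = \<zero>" if "b \<in> A" for b
      using r[OF that] by auto
    then have "A \<subseteq> {\<zero>}"
      using A(1) s(1) \<open>s \<noteq> \<zero>\<close> integral_iff by blast
    then show False
      using A_nz by blast
  qed
  then have unit: "inv a \<in> carrier K" "a \<otimes> inv a = \<one>"
    using aD field_Units by auto
  \<comment> \<open>\<open>s / a\<close> carries every generator of \<open>J\<close> into
    \<open>D\<close>, hence all of \<open>J\<close>, and \<open>a \<otimes> z = s\<close> is the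
    element outside \<open>M\<close>.\<close>
  define z where "z = s \<otimes> inv a"
  have z: "z \<in> carrier K"
    using unit s(1) by (simp add: z_def)
  have az: "a \<otimes> z = s"
    using unit s(1) aD m_lcomm[of a s "inv a"] by (simp add: z_def)
  have "ideal {b \<in> D. b \<otimes> z \<in> D} (K\<lparr>carrier := D\<rparr>)"
    using ideal_conductor[OF z] .
  moreover have "A \<subseteq> {b \<in> D. b \<otimes> z \<in> D}"
  proof
    fix b assume b: "b \<in> A"
    have bD: "b \<in> D"
      using b A(1) by blast
    obtain q where q: "q \<in> D" "s \<otimes> b = a \<otimes> q"
      using r[OF b] by blast
    have "b \<otimes> z = (s \<otimes> b) \<otimes> inv a"
      using bD s(1) unit(1) by (simp add: z_def m_ac)
    also have "\<dots> = q \<otimes> (a \<otimes> inv a)"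
      unfolding q(2) using q(1) aD unit(1) by (simp add: m_ac)
    finally show "b \<in> {b \<in> D. b \<otimes> z \<in> D}"
      using unit(2) q(1) bD by simp
  qed
  ultimately have "J \<subseteq> {b \<in> D. b \<otimes> z \<in> D}"
    by (rule J_min)
  then have "z \<in> ?T"
    using inverse_ideal_almost_integral[OF iI iJ IJ(2) disj c z] by blast
  moreover have "a \<in> E"
    using a AJ IJ(3) PE by blast
  ultimately have "s \<in> E"
    using E az by auto
  then show False
    using M(2) s by blast
qed

end

theorem theorem2p12:
  fixes K :: "('a, 'b) ring_scheme" and D P :: "'a set"
  assumes "pruefer_domain K D"
    and "P \<in> Spec K D"
  shows "P \<in> Spec_star K D \<longleftrightarrow>
    (\<forall>I J. fin_gen_ideal K D I \<and> fin_gen_ideal K D J \<and>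
           {\<zero>\<^bsub>K\<^esub>} \<noteq> I \<and> I \<subset> J \<and> J \<subseteq> P
       \<longrightarrow> minimal_primes K D I \<inter> minimal_primes K D J \<noteq> {})"
proof -
  have "field K"
    using assms(1) by (simp add: pruefer_domain_def is_quotient_field_def)
  then have "pruefer K D"
    using assms(1) by (simp add: pruefer_def pruefer_axioms_def)
  then show ?thesis
    using pruefer.not_Spec_star_if_disjoint_minimal_primes[of K D _ _ P]
      pruefer.disjoint_minimal_primes_if_not_Spec_star[of K D P] assms(2)
    by (metis psubset_imp_subset)
qed

end
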